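(* The operator $T:\ell^2(\mathbb{Z}\times\mathbb{Z})\to L^2(\mathbb{Z}\times[-\pi,\pi])$ is injective.
   Context: Fix a complex number $g_\omega\neq 0$ (coupling constant). For $\theta\in[-\pi,\pi]$ let $U_\omega(\theta)$ be the unitary operator on $\ell^2(\mathbb{Z})$ with matrix entries $(U_\omega(\theta))_{k,l}=e^{\mathrm{i}(k-l)\theta}J_{k-l}(2|g_\omega|)$, $k,l\in\mathbb{Z}$, where $J_n$ is the Bessel function of the first kind of order $n$. The forward operator $T:\ell^2(\mathbb{Z}\times\mathbb{Z})\to L^2(\mathbb{Z}\times[-\pi,\pi])$ (the target space carries counting measure times Lebesgue measure) is the bounded linear operator $$(T\rho)(l,\theta)=\big(U_\omega(\theta)\rho\,U_\omega(\theta)^*\big)_{l,l}=\sum_{m,n\in\mathbb{Z}}e^{\mathrm{i}(l-m)\theta}J_{l-m}(2|g_\omega|)\,\rho_{m,n}\,e^{-\mathrm{i}(l-n)\theta}J_{l-n}(2|g_\omega|),$$ where a matrix $\rho=(\rho_{j,k})_{j,k\in\mathbb{Z}}\in\ell^2(\mathbb{Z}\times\mathbb{Z})$ is identified with a Hilbert–Schmidt operator on $\ell^2(\mathbb{Z})$. *)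

theory Defs
  imports "HOL-Analysis.Analysis"
begin

definition bessel_J_nat :: "nat \<Rightarrow> real \<Rightarrow> real" where
  "bessel_J_nat n x = (\<Sum>k. (-1) ^ k / (fact k * fact (k + n)) * (x / 2) ^ (2 * k + n))"

definition bessel_J :: "int \<Rightarrow> real \<Rightarrow> real" where
  "bessel_J n x = (if n \<ge> 0 then bessel_J_nat (nat n) x
                   else (-1) ^ nat (- n) * bessel_J_nat (nat (- n)) x)"

definition U_entry :: "complex \<Rightarrow> real \<Rightarrow> int \<Rightarrow> int \<Rightarrow> complex" where
  "U_entry g \<theta> k l = exp (\<i> * of_int (k - l) * of_real \<theta>) * of_real (bessel_J (k - l) (2 * cmod g))"

definition ell2_ZZ :: "(int \<Rightarrow> int \<Rightarrow> complex) \<Rightarrow> bool" where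
  "ell2_ZZ \<rho> \<longleftrightarrow> (\<lambda>(m, n). (cmod (\<rho> m n))\<^sup>2) summable_on (UNIV :: (int \<times> int) set)"

text \<open>The forward operator: (T rho)(l, theta) = (U(theta) rho U(theta)^* )_{l,l}.\<close>
definition T_op :: "complex \<Rightarrow> (int \<Rightarrow> int \<Rightarrow> complex) \<Rightarrow> int \<Rightarrow> real \<Rightarrow> complex" where
  "T_op g \<rho> l \<theta> = (\<Sum>\<^sub>\<infinity>(m, n) \<in> (UNIV :: (int \<times> int) set).
      U_entry g \<theta> l m * \<rho> m n * cnj (U_entry g \<theta> l n))"

end

theory Submission
  imports Defs "HOL-Complex_Analysis.Complex_Analysis"
begin

text \<open>
  For fixed \<open>l\<close>, the function \<open>(T \<rho>)(l, \<theta>)\<close> is an absolutely convergent Fourier series in \<open>\<theta>\<close>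
  whose \<open>k\<close>-th coefficient is the convolution, at \<open>l\<close>, of the kernel
  \<open>h\<^sub>k(j) = J\<^sub>j J\<^sub>j\<^sub>-\<^sub>k\<close> with the diagonal \<open>c(m) = \<rho>\<^sub>m\<^sub>,\<^sub>m\<^sub>+\<^sub>k\<close>. If \<open>T \<rho> = 0\<close>, all these convolutions
  vanish. The symbol \<open>H(\<theta>) = \<Sum>\<^sub>j h\<^sub>k(j) e\<^sup>i\<^sup>j\<^sup>\<theta>\<close> extends holomorphically to a strip, because Bessel
  functions decay superexponentially in the order, and it is not identically zero, because
  \<open>J\<^sub>n(a) \<noteq> 0\<close> for large \<open>n\<close>. So it has finitely many zeros in \<open>[-\<pi>, \<pi>]\<close>, and convolution with \<open>h\<^sub>k\<close>
  is injective on \<open>\<ell>\<^sup>2(\<int>)\<close>.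
\<close>

section \<open>Absolutely convergent Fourier series\<close>

text \<open>An unordered sum over all integers. Since every character has modulus 1, it carries its
  intended value exactly when \<open>d\<close> is absolutely summable and defaults to 0
  otherwise.\<close>

definition fourier_series :: "(int \<Rightarrow> complex) \<Rightarrow> real \<Rightarrow> complex" where
  "fourier_series d \<theta> = (\<Sum>\<^sub>\<infinity>j. d j * cis (of_int j * \<theta>))"

text \<open>Orthogonality of the characters: for \<open>n \<noteq> 0\<close> the antiderivative has
  period 2 pi, so its values at the two endpoints cancel.\<close>

lemma cis_has_integral:
  "((\<lambda>\<theta>. cis (of_int n * \<theta>)) has_integral (if n = 0 then 2 * of_real pi else 0)) {-pi..pi}"
proof (cases "n = 0")
  case True
  then show ?thesis
    using has_integral_const_real[of "1::complex" "-pi" pi] by (simp add: scaleR_conv_of_real)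
next
  case False
  define F where "F \<theta> = cis (of_int n * \<theta>) / (\<i> * of_int n)" for \<theta> :: real
  have "(F has_vector_derivative cis (of_int n * \<theta>)) (at \<theta> within {-pi..pi})" for \<theta>
  proof -
    have "((\<lambda>z. exp (\<i> * (of_int n * z)) / (\<i> * of_int n)) has_field_derivative
        exp (\<i> * (of_int n * of_real \<theta>))) (at (of_real \<theta>))"
      using False by (auto intro!: derivative_eq_intros simp: mult_ac)
    from has_vector_derivative_real_field[OF this] show ?thesis
      by (simp add: F_def[abs_def] cis_conv_exp)
  qed
  then have "((\<lambda>\<theta>. cis (of_int n * \<theta>)) has_integral (F pi - F (-pi))) {-pi..pi}"
    by (intro fundamental_theorem_of_calculus) auto
  moreover have "cis (of_int n * (-pi)) = cis (of_int n * pi)"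
    by (simp add: complex_eq_iff mult.commute[of _ pi] sin_npi_int)
  ultimately show ?thesis
    using False by (simp add: F_def)
qed

text \<open>Writing the square as \<open>z * cnj z\<close> gives a double sum of characters of
  frequency \<open>j - k\<close>; by orthogonality only the diagonal survives.\<close>

lemma trig_polynomial_norm_has_integral:
  assumes "finite A"
  shows "((\<lambda>\<theta>. (cmod (\<Sum>j\<in>A. d j * cis (of_int j * \<theta>)))\<^sup>2) has_integral
          2 * pi * (\<Sum>j\<in>A. (cmod (d j))\<^sup>2)) {-pi..pi}"
proof -
  have "((\<lambda>\<theta>. \<Sum>j\<in>A. \<Sum>k\<in>A. (d j * cnj (d k)) * cis (of_int (j - k) * \<theta>)) has_integral
     (\<Sum>j\<in>A. \<Sum>k\<in>A. (d j * cnj (d k)) * (if j - k = 0 then 2 * of_real pi else 0))) {-pi..pi}"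
    by (intro has_integral_sum assms has_integral_mult_right cis_has_integral)
  also have "(\<lambda>\<theta>. \<Sum>j\<in>A. \<Sum>k\<in>A. (d j * cnj (d k)) * cis (of_int (j - k) * \<theta>)) =
     (\<lambda>\<theta>. of_real ((cmod (\<Sum>j\<in>A. d j * cis (of_int j * \<theta>)))\<^sup>2))"
    unfolding complex_norm_square cnj_sum sum_product
    by (intro ext sum.cong refl)
       (simp add: cis_cnj cis_mult algebra_simps flip: cis_divide)
  also have "(\<Sum>j\<in>A. \<Sum>k\<in>A. (d j * cnj (d k)) * (if j - k = 0 then 2 * of_real pi else 0)) =
     (\<Sum>j\<in>A. of_real (2 * pi * (cmod (d j))\<^sup>2))"
  proof (intro sum.cong refl)
    fix j assume "j \<in> A"
    have "(\<Sum>k\<in>A. (d j * cnj (d k)) * (if j - k = 0 then 2 * of_real pi else 0)) =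
          (\<Sum>k\<in>A. if j = k then d j * cnj (d j) * (2 * of_real pi) else 0)"
      by (intro sum.cong) auto
    also have "\<dots> = of_real (2 * pi * (cmod (d j))\<^sup>2)"
      using assms \<open>j \<in> A\<close> unfolding of_real_mult complex_norm_square by simp
    finally show "(\<Sum>k\<in>A. (d j * cnj (d k)) * (if j - k = 0 then 2 * of_real pi else 0)) =
       complex_of_real (2 * pi * (cmod (d j))\<^sup>2)" .
  qed
  finally have "((\<lambda>\<theta>. complex_of_real ((cmod (\<Sum>j\<in>A. d j * cis (of_int j * \<theta>)))\<^sup>2))
      has_integral complex_of_real (2 * pi * (\<Sum>j\<in>A. (cmod (d j))\<^sup>2))) {-pi..pi}"
    by (simp add: sum_distrib_left)
  from has_integral_linear[OF this bounded_linear_Re] show ?thesis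
    by (simp add: o_def)
qed

lemma fourier_series_uniform_limit:
  assumes "(\<lambda>j. norm (d j)) summable_on UNIV"
  shows "uniform_limit X (\<lambda>A \<theta>. \<Sum>j\<in>A. d j * cis (of_int j * \<theta>)) (fourier_series d)
    (finite_subsets_at_top UNIV)"
  unfolding fourier_series_def [abs_def]
  by (rule Weierstrass_m_test_general[where M = "\<lambda>j. norm (d j)"])
     (use assms in \<open>auto simp: norm_mult\<close>)

lemma continuous_on_fourier_series:
  assumes "(\<lambda>j. norm (d j)) summable_on UNIV"
  shows "continuous_on X (fourier_series d)"
  by (rule uniform_limit_theorem[OF _ fourier_series_uniform_limit[OF assms]])
     (auto intro!: always_eventually continuous_intros simp: cis_conv_exp)

text \<open>Uniform convergence of the partial sums lets the integral pass to the limit in the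
  identity for trigonometric polynomials. The limit runs along the net of finite subsets, which is
  the one in \<open>has_sum\<close>.\<close>

lemma parseval_abs_summable:
  assumes "(\<lambda>j. norm (d j)) summable_on UNIV"
  shows "((\<lambda>j. 2 * pi * (cmod (d j))\<^sup>2) has_sum
    integral {-pi..pi} (\<lambda>\<theta>. (cmod (fourier_series d \<theta>))\<^sup>2)) UNIV"
proof -
  let ?S = "\<lambda>A \<theta>. \<Sum>j\<in>A. d j * cis (of_int j * \<theta>)"
  note lim = fourier_series_uniform_limit[OF assms, of "{-pi..pi}"]
  have bd: "bounded (fourier_series d ` {-pi..pi})"
    by (intro compact_imp_bounded compact_continuous_image continuous_on_fourier_series assms) auto
  \<comment> \<open>Uniform limits multiply when the limit functions are bounded, hence
    \<open>bd\<close>; the squared modulus is then recovered as the real part of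
    \<open>z * cnj z\<close>.\<close>
  have "uniform_limit {-pi..pi} (\<lambda>A \<theta>. ?S A \<theta> * cnj (?S A \<theta>))
     (\<lambda>\<theta>. fourier_series d \<theta> * cnj (fourier_series d \<theta>)) (finite_subsets_at_top UNIV)"
    using bounded_linear_image[OF bd bounded_linear_cnj]
    by (intro uniform_lim_mult lim bd
       bounded_linear.uniform_limit[OF bounded_linear_cnj]) (auto simp: image_image)
  then have "uniform_limit {-pi..pi} (\<lambda>A \<theta>. (cmod (?S A \<theta>))\<^sup>2)
     (\<lambda>\<theta>. (cmod (fourier_series d \<theta>))\<^sup>2) (finite_subsets_at_top UNIV)"
    unfolding complex_norm_square[symmetric]
    by (drule_tac bounded_linear.uniform_limit[OF bounded_linear_Re]) simp
  then obtain I J where IJ: "\<And>A. ((\<lambda>\<theta>. (cmod (?S A \<theta>))\<^sup>2) has_integral I A) {-pi..pi}"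
    "((\<lambda>\<theta>. (cmod (fourier_series d \<theta>))\<^sup>2) has_integral J) {-pi..pi}"
    "(I \<longlongrightarrow> J) (finite_subsets_at_top UNIV)"
    by (rule uniform_limit_integral) (auto intro!: continuous_intros simp: cis_conv_exp)
  have "I A = (\<Sum>j\<in>A. 2 * pi * (cmod (d j))\<^sup>2)" if "finite A" for A
    using has_integral_unique[OF IJ(1) trig_polynomial_norm_has_integral[OF that]]
    by (simp add: sum_distrib_left)
  then have "(sum (\<lambda>j. 2 * pi * (cmod (d j))\<^sup>2) \<longlongrightarrow> J) (finite_subsets_at_top UNIV)"
    by (intro Lim_transform_eventually[OF IJ(3)] eventually_finite_subsets_at_top_weakI) auto
  then show ?thesis
    using IJ(2) unfolding has_sum_def by (simp add: integral_unique)
qed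

text \<open>The integral in Parseval's identity ignores null sets, so a sum of nonnegative terms
  vanishes and each term with it.\<close>

lemma fourier_series_AE_zero:
  assumes d: "(\<lambda>j. cmod (d j)) summable_on UNIV"
    and ae: "AE \<theta> in lborel. \<theta> \<in> {-pi..pi} \<longrightarrow> fourier_series d \<theta> = 0"
  shows "d j = 0"
proof -
  obtain N where N: "N \<in> null_sets lborel" "{\<theta>. \<not> (\<theta> \<in> {-pi..pi} \<longrightarrow> fourier_series d \<theta> = 0)} \<subseteq> N"
    using ae by (auto elim!: AE_E simp: null_sets_def)
  have "negligible N"
    using N(1) by (simp add: negligible_iff_null_sets null_sets_completionI)
  then have "integral {-pi..pi} (\<lambda>\<theta>. (cmod (fourier_series d \<theta>))\<^sup>2) = integral {-pi..pi} (\<lambda>_. 0)"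
    by (rule integral_spike) (use N(2) in auto)
  then have "((\<lambda>j. 2 * pi * (cmod (d j))\<^sup>2) has_sum 0) UNIV"
    using parseval_abs_summable[OF d] by simp
  then have "2 * pi * (cmod (d j))\<^sup>2 = 0"
    by (rule nonneg_has_sum_le_0D) auto
  then show ?thesis by simp
qed

text \<open>The weight \<open>exp \<bar>of_int j\<bar>\<close> dominates
  \<open>exp (\<i> * of_int j * z)\<close> on the strip where the imaginary part is between -1 and
  1, so the series extends holomorphically. Infinitely many zeros in the compact interval would
  accumulate, the identity theorem would make the extension vanish, and Parseval would force
  \<open>h j0 = 0\<close>.\<close>

lemma fourier_series_zeros_negligible:
  fixes h :: "int \<Rightarrow> complex"
  assumes h: "(\<lambda>j. cmod (h j) * exp \<bar>of_int j\<bar>) summable_on UNIV" and "h j0 \<noteq> 0"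
  shows "negligible {\<theta> \<in> {-pi..pi}. fourier_series h \<theta> = 0}"
proof (rule negligible_finite, rule ccontr)
  let ?Z = "{\<theta> \<in> {-pi..pi}. fourier_series h \<theta> = 0}"
  assume "infinite ?Z"
  define S where "S = {z. Im z < 1} \<inter> {z. Im z > -1}"
  define G where "G z = (\<Sum>\<^sub>\<infinity>j. h j * exp (\<i> * of_int j * z))" for z
  have S: "open S" "connected S"
    unfolding S_def
    by (auto intro!: open_Int open_halfspace_Im_lt open_halfspace_Im_gt convex_connected convex_Int
         convex_halfspace_Im_lt convex_halfspace_Im_gt)
  have G_real: "fourier_series h \<theta> = G (of_real \<theta>)" for \<theta>
    unfolding fourier_series_def G_def by (simp add: cis_conv_exp mult_ac)
  have G_lim: "uniform_limit S (\<lambda>A z. \<Sum>j\<in>A. h j * exp (\<i> * of_int j * z)) G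
      (finite_subsets_at_top UNIV)"
    unfolding G_def[abs_def]
  proof (rule Weierstrass_m_test_general[OF _ h])
    fix j :: int and z assume "z \<in> S"
    then have "\<bar>of_int j\<bar> * \<bar>Im z\<bar> \<le> \<bar>of_int j\<bar> * 1"
      by (intro mult_left_mono) (auto simp: S_def)
    then have "- (of_int j * Im z) \<le> \<bar>of_int j\<bar>"
      using abs_ge_minus_self[of "of_int j * Im z"] by (simp add: abs_mult)
    then show "cmod (h j * exp (\<i> * of_int j * z)) \<le> cmod (h j) * exp \<bar>of_int j\<bar>"
      by (simp add: norm_mult mult_left_mono)
  qed
  \<comment> \<open>Holomorphy is local: uniform convergence is used on a closed ball inside the
    strip around each point.\<close>
  have "G holomorphic_on S"
    unfolding holomorphic_on_open[OF S(1)]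
  proof
    fix z assume "z \<in> S"
    then obtain r where r: "r > 0" "cball z r \<subseteq> S"
      using S(1) open_contains_cball by blast
    have "G holomorphic_on ball z r"
      by (rule holomorphic_uniform_limit[OF _ uniform_limit_on_subset[OF G_lim r(2)]])
         (auto intro!: always_eventually continuous_intros holomorphic_intros)
    then show "\<exists>f'. (G has_field_derivative f') (at z)"
      using r(1) by (auto simp: holomorphic_on_open)
  qed
  obtain x where x: "x islimpt ?Z"
    using \<open>infinite ?Z\<close> compact_eq_Bolzano_Weierstrass[of "{-pi..pi}"] compact_Icc by blast
  have limpt: "complex_of_real x islimpt of_real ` ?Z"
    unfolding islimpt_approachable
  proof (intro allI impI)
    fix e :: real assume "e > 0"
    then obtain y where "y \<in> ?Z" "y \<noteq> x" "dist y x < e"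
      using x unfolding islimpt_approachable by blast
    then show "\<exists>y'\<in>complex_of_real ` ?Z. y' \<noteq> of_real x \<and> dist y' (of_real x) < e"
      by (intro bexI[of _ "of_real y"]) (auto simp: dist_norm simp flip: of_real_diff)
  qed
  have "G (of_real \<theta>) = 0" for \<theta>
    by (rule analytic_continuation[OF \<open>G holomorphic_on S\<close> S _ _ limpt])
       (auto simp: S_def G_real)
  then have "((\<lambda>j. 2 * pi * (cmod (h j))\<^sup>2) has_sum 0) UNIV"
    using parseval_abs_summable[of h] summable_on_comparison_test[OF h, of "\<lambda>j. cmod (h j)"]
    by (simp add: G_real mult_le_cancel_left1)
  then have "2 * pi * (cmod (h j0))\<^sup>2 = 0"
    by (rule nonneg_has_sum_le_0D) auto
  then show False
    using \<open>h j0 \<noteq> 0\<close> by simp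
qed

section \<open>Convolution operators on square summable sequences\<close>

lemma int_translate_bij: "bij_betw (\<lambda>l. l - m) UNIV (UNIV :: int set)"
  by (rule bij_betw_byWitness[where f' = "\<lambda>l. l + m"]) auto

lemma int_reflect_bij: "bij_betw (\<lambda>m. l - m) UNIV (UNIV :: int set)"
  by (rule bij_betw_byWitness[where f' = "\<lambda>m. l - m"]) auto

lemma summable_on_bounded_mult:
  fixes w x :: "'a \<Rightarrow> real"
  assumes "w summable_on A" "\<And>i. i \<in> A \<Longrightarrow> 0 \<le> w i" "\<And>i. i \<in> A \<Longrightarrow> 0 \<le> x i" "\<And>i. i \<in> A \<Longrightarrow> x i \<le> K"
  shows "(\<lambda>i. w i * x i) summable_on A"
  by (rule summable_on_comparison_test[OF summable_on_cmult_left[OF assms(1), of K]])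
     (use assms in \<open>auto intro!: mult_left_mono\<close>)

lemma square_summable_bounded:
  fixes c :: "'a \<Rightarrow> complex"
  assumes "(\<lambda>m. (cmod (c m))\<^sup>2) summable_on UNIV"
  shows "cmod (c m) \<le> sqrt (\<Sum>\<^sub>\<infinity>m. (cmod (c m))\<^sup>2)"
  using finite_sum_le_infsum[OF assms, of "{m}"] by (intro real_le_rsqrt) auto

text \<open>The finite inequality, applied to \<open>sqrt (w i)\<close> and
  \<open>sqrt (w i) * x i\<close>, survives the limit over finite subsets of
  \<open>A\<close>.\<close>

lemma infsum_weighted_Cauchy_Schwarz:
  fixes w x :: "'a \<Rightarrow> real"
  assumes w: "w summable_on A" "\<And>i. i \<in> A \<Longrightarrow> 0 \<le> w i"
    and wx: "(\<lambda>i. w i * x i) summable_on A" and wx2: "(\<lambda>i. w i * (x i)\<^sup>2) summable_on A"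
  shows "(\<Sum>\<^sub>\<infinity>i\<in>A. w i * x i)\<^sup>2 \<le> (\<Sum>\<^sub>\<infinity>i\<in>A. w i) * (\<Sum>\<^sub>\<infinity>i\<in>A. w i * (x i)\<^sup>2)"
proof (rule tendsto_le)
  show "((\<lambda>F. (\<Sum>i\<in>F. w i * x i)\<^sup>2) \<longlongrightarrow> (\<Sum>\<^sub>\<infinity>i\<in>A. w i * x i)\<^sup>2) (finite_subsets_at_top A)"
    by (intro tendsto_power infsum_tendsto wx)
  show "((\<lambda>F. (\<Sum>i\<in>F. w i) * (\<Sum>i\<in>F. w i * (x i)\<^sup>2)) \<longlongrightarrow>
      (\<Sum>\<^sub>\<infinity>i\<in>A. w i) * (\<Sum>\<^sub>\<infinity>i\<in>A. w i * (x i)\<^sup>2)) (finite_subsets_at_top A)"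
    by (intro tendsto_mult infsum_tendsto w wx2)
  show "\<forall>\<^sub>F F in finite_subsets_at_top A.
      (\<Sum>i\<in>F. w i * x i)\<^sup>2 \<le> (\<Sum>i\<in>F. w i) * (\<Sum>i\<in>F. w i * (x i)\<^sup>2)"
  proof (rule eventually_finite_subsets_at_top_weakI)
    fix F assume F: "finite F" "F \<subseteq> A"
    have "(\<Sum>i\<in>F. sqrt (w i) * (sqrt (w i) * x i))\<^sup>2 \<le>
        (\<Sum>i\<in>F. (sqrt (w i))\<^sup>2) * (\<Sum>i\<in>F. (sqrt (w i) * x i)\<^sup>2)"
      by (rule Cauchy_Schwarz_ineq_sum)
    moreover have "(\<Sum>i\<in>F. sqrt (w i) * (sqrt (w i) * x i)) = (\<Sum>i\<in>F. w i * x i)"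
      "(\<Sum>i\<in>F. (sqrt (w i))\<^sup>2) = (\<Sum>i\<in>F. w i)"
      "(\<Sum>i\<in>F. (sqrt (w i) * x i)\<^sup>2) = (\<Sum>i\<in>F. w i * (x i)\<^sup>2)"
      using F w(2) by (auto intro!: sum.cong simp: power_mult_distrib simp flip: mult.assoc)
    ultimately show "(\<Sum>i\<in>F. w i * x i)\<^sup>2 \<le> (\<Sum>i\<in>F. w i) * (\<Sum>i\<in>F. w i * (x i)\<^sup>2)"
      by simp
  qed
qed simp

lemma has_sum_finite_sum:
  fixes f :: "'a \<Rightarrow> 'b \<Rightarrow> 'c::topological_comm_monoid_add"
  assumes "finite I" "\<And>i. i \<in> I \<Longrightarrow> (f i has_sum s i) A"
  shows "((\<lambda>x. \<Sum>i\<in>I. f i x) has_sum (\<Sum>i\<in>I. s i)) A"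
  using assms by (induction I rule: finite_induct) (auto intro: has_sum_add has_sum_0)

text \<open>Tonelli: summing over \<open>l\<close> first, translation invariance gives the total
  \<open>infsum h UNIV * b m\<close> for each \<open>m\<close>.\<close>

lemma convolution_has_sum:
  fixes h b :: "int \<Rightarrow> real"
  assumes h: "h summable_on UNIV" "\<And>j. 0 \<le> h j"
    and b: "b summable_on A" "\<And>m. m \<in> A \<Longrightarrow> 0 \<le> b m"
  shows "((\<lambda>l. \<Sum>\<^sub>\<infinity>m\<in>A. h (l - m) * b m) has_sum infsum h UNIV * infsum b A) UNIV"
proof -
  have hs: "((\<lambda>l. h (l - m) * b m) has_sum infsum h UNIV * b m) UNIV" for m
    using has_sum_reindex_bij_betw[OF int_translate_bij, of h m] h(1)
    by (intro has_sum_cmult_left) simp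
  have tot: "((\<lambda>m. infsum h UNIV * b m) has_sum infsum h UNIV * infsum b A) A"
    by (intro has_sum_cmult_right has_sum_infsum b)
  have summ: "(\<lambda>(m, l). h (l - m) * b m) summable_on A \<times> UNIV"
    by (rule summable_on_SigmaI[where g = "\<lambda>m. infsum h UNIV * b m"])
       (use hs tot h b in \<open>auto intro: has_sum_imp_summable\<close>)
  have summ': "(\<lambda>(l, m). h (l - m) * b m) summable_on UNIV \<times> A"
    using summ by (rule summable_on_swap[THEN iffD1, of "\<lambda>(m, l). h (l - m) * b m", simplified])
  have "(\<lambda>l. \<Sum>\<^sub>\<infinity>m\<in>A. h (l - m) * b m) summable_on UNIV"
    using summable_on_Sigma_banach[OF summ'] by simp
  moreover have "(\<Sum>\<^sub>\<infinity>l. \<Sum>\<^sub>\<infinity>m\<in>A. h (l - m) * b m) = (\<Sum>\<^sub>\<infinity>m\<in>A. \<Sum>\<^sub>\<infinity>l. h (l - m) * b m)"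
    by (rule infsum_swap_banach[OF summ'])
  moreover have "\<dots> = infsum h UNIV * infsum b A"
    using infsumI[OF hs] infsumI[OF tot] by simp
  ultimately show ?thesis
    by (simp add: has_sum_iff)
qed

text \<open>As the full convolution vanishes, the part of \<open>c\<close> on \<open>A\<close> and
  the part on \<open>-A\<close> have opposite convolutions with \<open>h\<close>. Young's inequality
  (l1 convolved with l2 lies in l2) then bounds the first by the tail of \<open>c\<close>.\<close>

lemma convolution_tail_bound:
  fixes h c :: "int \<Rightarrow> complex"
  assumes h: "(\<lambda>j. cmod (h j)) summable_on UNIV"
    and c: "(\<lambda>m. (cmod (c m))\<^sup>2) summable_on UNIV"
    and conv: "\<And>l. (\<Sum>\<^sub>\<infinity>m. h (l - m) * c m) = 0"
    and A: "finite A"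
  shows "(\<Sum>\<^sub>\<infinity>l. (cmod (\<Sum>m\<in>A. h (l - m) * c m))\<^sup>2) \<le>
    (\<Sum>\<^sub>\<infinity>j. cmod (h j))\<^sup>2 * (\<Sum>\<^sub>\<infinity>m\<in>-A. (cmod (c m))\<^sup>2)"
proof -
  define H where "H = (\<Sum>\<^sub>\<infinity>j. cmod (h j))"
  define K where "K = sqrt (\<Sum>\<^sub>\<infinity>m. (cmod (c m))\<^sup>2)"
  have K: "cmod (c m) \<le> K" for m
    unfolding K_def by (rule square_summable_bounded[OF c])
  have hl: "(\<lambda>m. cmod (h (l - m))) summable_on B" for l B
    using summable_on_reindex_bij_betw[OF int_reflect_bij, of "\<lambda>j. cmod (h j)" l] h
    by (intro summable_on_subset_banach[of _ UNIV B]) auto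
  have Hl: "(\<Sum>\<^sub>\<infinity>m\<in>B. cmod (h (l - m))) \<le> H" for l B
  proof -
    have "(\<Sum>\<^sub>\<infinity>m\<in>B. cmod (h (l - m))) \<le> (\<Sum>\<^sub>\<infinity>m. cmod (h (l - m)))"
      by (rule infsum_mono2) (auto intro: hl)
    then show ?thesis
      unfolding H_def using infsum_reindex_bij_betw[OF int_reflect_bij, of "\<lambda>j. cmod (h j)" l] by simp
  qed
  have hc: "(\<lambda>m. cmod (h (l - m)) * cmod (c m)) summable_on B" for l B
    by (rule summable_on_bounded_mult[OF hl, where K = K]) (auto intro: K)
  have hc2: "(\<lambda>m. cmod (h (l - m)) * (cmod (c m))\<^sup>2) summable_on B" for l B
    by (rule summable_on_bounded_mult[OF hl, where K = "K\<^sup>2"]) (auto intro!: power_mono K)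
  have hcc: "(\<lambda>m. h (l - m) * c m) summable_on B" for l B
    by (rule abs_summable_summable) (use hc in \<open>simp add: norm_mult\<close>)
  \<comment> \<open>Cauchy-Schwarz with weights \<open>cmod (h (l - m))\<close>, whose total is at
    most \<open>H\<close>; this gives the first of the two factors \<open>H\<close>.\<close>
  have bound: "(cmod (\<Sum>m\<in>A. h (l - m) * c m))\<^sup>2 \<le>
      H * (\<Sum>\<^sub>\<infinity>m\<in>-A. cmod (h (l - m)) * (cmod (c m))\<^sup>2)" for l
  proof -
    have "0 = (\<Sum>\<^sub>\<infinity>m\<in>A \<union> -A. h (l - m) * c m)"
      using conv[of l] by simp
    also have "\<dots> = (\<Sum>\<^sub>\<infinity>m\<in>A. h (l - m) * c m) + (\<Sum>\<^sub>\<infinity>m\<in>-A. h (l - m) * c m)"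
      by (rule infsum_Un_disjoint) (auto intro: hcc)
    finally have "(\<Sum>m\<in>A. h (l - m) * c m) = - (\<Sum>\<^sub>\<infinity>m\<in>-A. h (l - m) * c m)"
      using A by (simp add: eq_neg_iff_add_eq_0)
    then have "cmod (\<Sum>m\<in>A. h (l - m) * c m) = cmod (\<Sum>\<^sub>\<infinity>m\<in>-A. h (l - m) * c m)"
      by simp
    also have "\<dots> \<le> (\<Sum>\<^sub>\<infinity>m\<in>-A. cmod (h (l - m)) * cmod (c m))"
      using norm_infsum_bound[of "\<lambda>m. h (l - m) * c m" "-A"] hc by (simp add: norm_mult)
    finally have "(cmod (\<Sum>m\<in>A. h (l - m) * c m))\<^sup>2 \<le> (\<Sum>\<^sub>\<infinity>m\<in>-A. cmod (h (l - m)) * cmod (c m))\<^sup>2"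
      by (rule power_mono) simp
    also have "\<dots> \<le> (\<Sum>\<^sub>\<infinity>m\<in>-A. cmod (h (l - m))) * (\<Sum>\<^sub>\<infinity>m\<in>-A. cmod (h (l - m)) * (cmod (c m))\<^sup>2)"
      by (rule infsum_weighted_Cauchy_Schwarz) (auto intro: hl hc hc2)
    also have "\<dots> \<le> H * (\<Sum>\<^sub>\<infinity>m\<in>-A. cmod (h (l - m)) * (cmod (c m))\<^sup>2)"
      by (intro mult_right_mono Hl infsum_nonneg) auto
    finally show ?thesis .
  qed
  \<comment> \<open>Summation over \<open>l\<close> gives the second factor
    \<open>H\<close>.\<close>
  have "((\<lambda>l. \<Sum>\<^sub>\<infinity>m\<in>-A. cmod (h (l - m)) * (cmod (c m))\<^sup>2) has_sum
      H * (\<Sum>\<^sub>\<infinity>m\<in>-A. (cmod (c m))\<^sup>2)) UNIV"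
    unfolding H_def
    by (rule convolution_has_sum) (auto intro: h summable_on_subset_banach[OF c])
  from has_sum_cmult_right[OF this, of H]
  have rhs: "((\<lambda>l. H * (\<Sum>\<^sub>\<infinity>m\<in>-A. cmod (h (l - m)) * (cmod (c m))\<^sup>2)) has_sum
      H\<^sup>2 * (\<Sum>\<^sub>\<infinity>m\<in>-A. (cmod (c m))\<^sup>2)) UNIV"
    by (simp add: power2_eq_square mult_ac)
  have lhs: "(\<lambda>l. (cmod (\<Sum>m\<in>A. h (l - m) * c m))\<^sup>2) summable_on UNIV"
    by (rule summable_on_comparison_test[OF has_sum_imp_summable[OF rhs]]) (auto intro: bound)
  have "(\<Sum>\<^sub>\<infinity>l. (cmod (\<Sum>m\<in>A. h (l - m) * c m))\<^sup>2) \<le> H\<^sup>2 * (\<Sum>\<^sub>\<infinity>m\<in>-A. (cmod (c m))\<^sup>2)"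
    by (rule has_sum_mono[OF has_sum_infsum[OF lhs] rhs]) (rule bound)
  then show ?thesis
    by (simp add: H_def)
qed

text \<open>Shifting \<open>h\<close> by \<open>m\<close> multiplies its series by
  \<open>cis (of_int m * \<theta>)\<close>. As \<open>A\<close> is finite, the shifts may be added
  term by term.\<close>

lemma fourier_series_convolution:
  fixes h c :: "int \<Rightarrow> complex"
  assumes h: "(\<lambda>j. cmod (h j)) summable_on UNIV" and A: "finite A"
  shows "(\<lambda>l. cmod (\<Sum>m\<in>A. h (l - m) * c m)) summable_on UNIV"
    and "fourier_series (\<lambda>l. \<Sum>m\<in>A. h (l - m) * c m) \<theta> =
      fourier_series h \<theta> * (\<Sum>m\<in>A. c m * cis (of_int m * \<theta>))"
proof -
  have "(\<lambda>l. cmod (h (l - m)) * cmod (c m)) summable_on UNIV" for m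
    using summable_on_reindex_bij_betw[OF int_translate_bij, of "\<lambda>j. cmod (h j)" m] h
    by (intro summable_on_cmult_left) simp
  then have "(\<lambda>l. \<Sum>m\<in>A. cmod (h (l - m)) * cmod (c m)) summable_on UNIV"
    using has_sum_finite_sum[OF A, of "\<lambda>m l. cmod (h (l - m)) * cmod (c m)"]
    by (meson has_sum_imp_summable has_sum_infsum)
  then show "(\<lambda>l. cmod (\<Sum>m\<in>A. h (l - m) * c m)) summable_on UNIV"
    by (rule summable_on_comparison_test) (auto intro!: sum_norm_le simp: norm_mult)
  have "(\<lambda>j. h j * cis (of_int j * \<theta>)) summable_on UNIV"
    by (rule abs_summable_summable) (use h in \<open>simp add: norm_mult\<close>)
  then have hs: "((\<lambda>j. h j * cis (of_int j * \<theta>)) has_sum fourier_series h \<theta>) UNIV"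
    unfolding fourier_series_def by (rule has_sum_infsum)
  have "((\<lambda>l. h (l - m) * c m * cis (of_int l * \<theta>)) has_sum
      fourier_series h \<theta> * (c m * cis (of_int m * \<theta>))) UNIV" for m
  proof -
    have "((\<lambda>l. h (l - m) * cis (of_int (l - m) * \<theta>)) has_sum fourier_series h \<theta>) UNIV"
      using hs has_sum_reindex_bij_betw[OF int_translate_bij, of "\<lambda>j. h j * cis (of_int j * \<theta>)" m] by blast
    from has_sum_cmult_left[OF this, of "c m * cis (of_int m * \<theta>)"] show ?thesis
    proof (rule has_sum_cong[THEN iffD1, rotated])
      fix l :: int
      have "cis (of_int l * \<theta>) = cis (of_int (l - m) * \<theta>) * cis (of_int m * \<theta>)"
        by (simp add: cis_mult algebra_simps)
      then show "h (l - m) * cis (of_int (l - m) * \<theta>) * (c m * cis (of_int m * \<theta>)) =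
          h (l - m) * c m * cis (of_int l * \<theta>)"
        by simp
    qed
  qed
  then have "((\<lambda>l. \<Sum>m\<in>A. h (l - m) * c m * cis (of_int l * \<theta>)) has_sum
      (\<Sum>m\<in>A. fourier_series h \<theta> * (c m * cis (of_int m * \<theta>)))) UNIV"
    using A by (intro has_sum_finite_sum) auto
  then show "fourier_series (\<lambda>l. \<Sum>m\<in>A. h (l - m) * c m) \<theta> =
      fourier_series h \<theta> * (\<Sum>m\<in>A. c m * cis (of_int m * \<theta>))"
    unfolding fourier_series_def[of "\<lambda>l. \<Sum>m\<in>A. h (l - m) * c m"]
    by (simp add: infsumI sum_distrib_right sum_distrib_left)
qed

text \<open>The integral of \<open>(t * f x - g x)\<^sup>2\<close> is a quadratic in
  \<open>t\<close> that is never negative.\<close>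

lemma integral_Cauchy_Schwarz:
  fixes f g :: "real \<Rightarrow> real"
  assumes f: "continuous_on {a..b} f" and g: "continuous_on {a..b} g"
  shows "(integral {a..b} (\<lambda>x. f x * g x))\<^sup>2 \<le>
    integral {a..b} (\<lambda>x. (f x)\<^sup>2) * integral {a..b} (\<lambda>x. (g x)\<^sup>2)"
proof -
  define A B C where "A = integral {a..b} (\<lambda>x. (f x)\<^sup>2)"
    and "B = integral {a..b} (\<lambda>x. f x * g x)" and "C = integral {a..b} (\<lambda>x. (g x)\<^sup>2)"
  have quad: "0 \<le> t\<^sup>2 * A - 2 * t * B + C" for t
  proof -
    have ints: "(\<lambda>x. (f x)\<^sup>2) integrable_on {a..b}" "(\<lambda>x. f x * g x) integrable_on {a..b}"
      "(\<lambda>x. (g x)\<^sup>2) integrable_on {a..b}"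
      by (auto intro!: integrable_continuous_real continuous_intros f g)
    have "((\<lambda>x. t\<^sup>2 * (f x)\<^sup>2 - 2 * t * (f x * g x) + (g x)\<^sup>2) has_integral
        t\<^sup>2 * A - 2 * t * B + C) {a..b}"
      unfolding A_def B_def C_def
      by (intro has_integral_add has_integral_diff has_integral_mult_right
           integrable_integral ints)
    moreover have "t\<^sup>2 * (f x)\<^sup>2 - 2 * t * (f x * g x) + (g x)\<^sup>2 = (t * f x - g x)\<^sup>2" for x
      by (simp add: power2_eq_square algebra_simps)
    ultimately show ?thesis
      by (auto elim!: has_integral_nonneg)
  qed
  have "A \<ge> 0"
    unfolding A_def by (rule integral_nonneg) (auto intro!: integrable_continuous_real continuous_intros f)
  have "B\<^sup>2 \<le> A * C"
  proof (cases "A = 0")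
    case True
    \<comment> \<open>With \<open>A = 0\<close> and \<open>B \<noteq> 0\<close> this choice of
      \<open>t\<close> would make the quadratic equal to -1.\<close>
    then have "B = 0"
      using quad[of "(C + 1) / (2 * B)"] by (cases "B = 0") auto
    then show ?thesis using True by simp
  next
    case False
    with \<open>A \<ge> 0\<close> have "A > 0" by simp
    then show ?thesis
      \<comment> \<open>The minimiser of the quadratic.\<close>
      using quad[of "B / A"] by (simp add: field_simps power2_eq_square)
  qed
  then show ?thesis
    by (simp add: A_def B_def C_def)
qed

lemma convolution_kernel_trivial:
  fixes h c :: "int \<Rightarrow> complex"
  assumes h: "(\<lambda>j. cmod (h j)) summable_on UNIV"
    and zeros: "negligible {\<theta> \<in> {-pi..pi}. fourier_series h \<theta> = 0}"
    and c: "(\<lambda>m. (cmod (c m))\<^sup>2) summable_on UNIV"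
    and conv: "\<And>l. (\<Sum>\<^sub>\<infinity>m. h (l - m) * c m) = 0"
  shows "c k = 0"
  \<comment> \<open>Let \<open>P\<close> be the trigonometric polynomial of \<open>c\<close> restricted to a finite set \<open>A\<close>. Then
    \<open>2 * pi * cmod (c k)\<close> is at most the integral of \<open>\<bar>P\<bar> = \<bar>P\<bar> r + \<bar>H P\<bar> q\<close>, where \<open>r = \<epsilon> / (\<bar>H\<bar>\<^sup>2 + \<epsilon>)\<close> and
    \<open>q = \<bar>H\<bar> / (\<bar>H\<bar>\<^sup>2 + \<epsilon>)\<close>. As \<open>A\<close> grows, \<open>H P\<close> tends to \<open>0\<close> in \<open>L\<^sup>2\<close>, and \<open>r\<close> tends to \<open>0\<close> in \<open>L\<^sup>2\<close>
    as \<open>\<epsilon>\<close> does.\<close>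
proof -
  define H where "H = fourier_series h"
  define C where "C = (\<Sum>\<^sub>\<infinity>m. (cmod (c m))\<^sup>2)"
  define tail where "tail A = (\<Sum>\<^sub>\<infinity>m\<in>-A. (cmod (c m))\<^sup>2)" for A
  define M where "M = 2 * pi * (\<Sum>\<^sub>\<infinity>j. cmod (h j))\<^sup>2"
  define \<epsilon> :: "nat \<Rightarrow> real" where "\<epsilon> n = inverse (Suc n)" for n
  define r q where "r n \<theta> = \<epsilon> n / ((cmod (H \<theta>))\<^sup>2 + \<epsilon> n)"
    and "q n \<theta> = cmod (H \<theta>) / ((cmod (H \<theta>))\<^sup>2 + \<epsilon> n)" for n \<theta>
  define R Q where "R n = integral {-pi..pi} (\<lambda>\<theta>. (r n \<theta>)\<^sup>2)"
    and "Q n = integral {-pi..pi} (\<lambda>\<theta>. (q n \<theta>)\<^sup>2)" for n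
  have \<epsilon>: "\<epsilon> n > 0" for n
    by (simp add: \<epsilon>_def)
  have den: "(cmod (H \<theta>))\<^sup>2 + \<epsilon> n > 0" for \<theta> n
    using \<epsilon>[of n] by (simp add: add_nonneg_pos)
  have contH [continuous_intros]: "continuous_on X H" for X
    unfolding H_def by (rule continuous_on_fourier_series[OF h])
  have contr [continuous_intros]: "continuous_on X (r n)" for X n
    unfolding r_def[abs_def] using den by (auto intro!: continuous_intros simp: order_less_imp_not_eq2)
  have contq [continuous_intros]: "continuous_on X (q n)" for X n
    unfolding q_def[abs_def] using den by (auto intro!: continuous_intros simp: order_less_imp_not_eq2)
  have rq: "r n \<theta> + cmod (H \<theta>) * q n \<theta> = 1" for n \<theta>
  proof -
    have "r n \<theta> + cmod (H \<theta>) * q n \<theta> = ((cmod (H \<theta>))\<^sup>2 + \<epsilon> n) / ((cmod (H \<theta>))\<^sup>2 + \<epsilon> n)"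
      unfolding add_divide_distrib by (simp add: r_def q_def power2_eq_square)
    then show ?thesis using den[of \<theta> n] by simp
  qed
  have tail: "tail A = C - (\<Sum>m\<in>A. (cmod (c m))\<^sup>2)" if "finite A" for A
    using infsum_Un_disjoint[of "\<lambda>m. (cmod (c m))\<^sup>2" A "-A"] that
      summable_on_subset_banach[OF c, of "-A"]
    by (simp add: tail_def C_def)
  have tail_lim: "(tail \<longlongrightarrow> 0) (finite_subsets_at_top UNIV)"
  proof -
    have "((\<lambda>A. C - (\<Sum>m\<in>A. (cmod (c m))\<^sup>2)) \<longlongrightarrow> C - C) (finite_subsets_at_top UNIV)"
      unfolding C_def by (intro tendsto_diff tendsto_const infsum_tendsto c)
    then have "((\<lambda>A. C - (\<Sum>m\<in>A. (cmod (c m))\<^sup>2)) \<longlongrightarrow> 0) (finite_subsets_at_top UNIV)"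
      by simp
    then show ?thesis
      by (rule Lim_transform_eventually) (auto intro!: eventually_finite_subsets_at_top_weakI simp: tail)
  qed
  \<comment> \<open>Pointwise, \<open>r n\<close> tends to the indicator of the zero set of
    \<open>H\<close>, which is negligible by \<open>zeros\<close>; the constant 1 dominates.\<close>
  have R_lim: "R \<longlonglongrightarrow> 0"
  proof -
    let ?g = "\<lambda>\<theta>. if H \<theta> = 0 then 1 else (0::real)"
    have "R \<longlonglongrightarrow> integral {-pi..pi} ?g"
      unfolding R_def[abs_def]
    proof (rule dominated_convergence(2)[where h = "\<lambda>_. 1"])
      show "(\<lambda>\<theta>. (r n \<theta>)\<^sup>2) integrable_on {-pi..pi}" for n
        by (intro integrable_continuous_real continuous_intros)
      show "norm ((r n \<theta>)\<^sup>2) \<le> 1" for n \<theta>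
        using den[of \<theta> n] \<epsilon>[of n] by (simp add: r_def power_le_one)
      show "(\<lambda>n. (r n \<theta>)\<^sup>2) \<longlonglongrightarrow> ?g \<theta>" for \<theta>
      proof (cases "H \<theta> = 0")
        case True
        then show ?thesis using \<epsilon> by (simp add: r_def order_less_imp_not_eq2)
      next
        case False
        have "\<epsilon> \<longlonglongrightarrow> 0"
          unfolding \<epsilon>_def by (rule LIMSEQ_inverse_real_of_nat)
        then have "(\<lambda>n. (r n \<theta>)\<^sup>2) \<longlonglongrightarrow> (0 / ((cmod (H \<theta>))\<^sup>2 + 0))\<^sup>2"
          unfolding r_def using False by (intro tendsto_intros) auto
        then show ?thesis using False by simp
      qed
    qed auto
    also have "integral {-pi..pi} ?g = integral {-pi..pi} (\<lambda>_. 0)"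
      by (rule integral_spike[OF zeros]) (auto simp: H_def)
    finally show ?thesis by simp
  qed
  have key: "2 * pi * cmod (c k) \<le> sqrt (2 * pi * C * R n) + sqrt (M * tail A * Q n)"
    if A: "finite A" "k \<in> A" for A n
  proof -
    define P where "P \<theta> = (\<Sum>m\<in>A. c m * cis (of_int m * \<theta>))" for \<theta>
    have contP [continuous_intros]: "continuous_on X P" for X
      unfolding P_def[abs_def] cis_conv_exp by (intro continuous_intros)
    have CS: "integral {-pi..pi} (\<lambda>\<theta>. u \<theta> * v \<theta>) \<le> sqrt (x * y)"
      if "continuous_on {-pi..pi} u" "continuous_on {-pi..pi} v"
        "integral {-pi..pi} (\<lambda>\<theta>. (u \<theta>)\<^sup>2) \<le> x" "integral {-pi..pi} (\<lambda>\<theta>. (v \<theta>)\<^sup>2) = y"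
      for u v :: "real \<Rightarrow> real" and x y
    proof (rule real_le_rsqrt)
      have "0 \<le> y"
        unfolding that(4)[symmetric]
        by (rule integral_nonneg) (use that in \<open>auto intro!: integrable_continuous_real continuous_intros\<close>)
      with integral_Cauchy_Schwarz[OF that(1,2)] mult_right_mono[OF that(3), of y]
      show "(integral {-pi..pi} (\<lambda>\<theta>. u \<theta> * v \<theta>))\<^sup>2 \<le> x * y"
        using that(4) by simp
    qed
    \<comment> \<open>Integrating \<open>P\<close> against the conjugate character of frequency
      \<open>k\<close> extracts \<open>c k\<close>, because \<open>k \<in> A\<close>.\<close>
    have "((\<lambda>\<theta>. \<Sum>m\<in>A. c m * cis (of_int (m - k) * \<theta>)) has_integral
        (\<Sum>m\<in>A. c m * (if m - k = 0 then 2 * of_real pi else 0))) {-pi..pi}"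
      by (intro has_integral_sum A has_integral_mult_right cis_has_integral)
    also have "(\<lambda>\<theta>. \<Sum>m\<in>A. c m * cis (of_int (m - k) * \<theta>)) = (\<lambda>\<theta>. P \<theta> * cis (- (of_int k * \<theta>)))"
      by (auto simp: P_def sum_distrib_right cis_mult left_diff_distrib mult.assoc intro!: ext sum.cong)
    also have "(\<Sum>m\<in>A. c m * (if m - k = 0 then 2 * of_real pi else 0)) =
        (\<Sum>m\<in>A. if m = k then c k * (2 * of_real pi) else 0)"
      by (intro sum.cong) auto
    also have "\<dots> = c k * (2 * of_real pi)"
      using A by simp
    finally have "integral {-pi..pi} (\<lambda>\<theta>. P \<theta> * cis (- (of_int k * \<theta>))) = c k * (2 * of_real pi)"
      by (rule integral_unique)
    then have "2 * pi * cmod (c k) = cmod (integral {-pi..pi} (\<lambda>\<theta>. P \<theta> * cis (- (of_int k * \<theta>))))"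
      by (simp add: norm_mult)
    also have "\<dots> \<le> integral {-pi..pi} (\<lambda>\<theta>. cmod (P \<theta>))"
      by (rule integral_norm_bound_integral)
         (auto intro!: integrable_continuous_real continuous_intros simp: norm_mult cis_conv_exp)
    also have "(\<lambda>\<theta>. cmod (P \<theta>)) = (\<lambda>\<theta>. cmod (P \<theta>) * r n \<theta> + cmod (H \<theta> * P \<theta>) * q n \<theta>)"
    proof
      fix \<theta>
      have "cmod (P \<theta>) = cmod (P \<theta>) * (r n \<theta> + cmod (H \<theta>) * q n \<theta>)"
        by (simp add: rq)
      then show "cmod (P \<theta>) = cmod (P \<theta>) * r n \<theta> + cmod (H \<theta> * P \<theta>) * q n \<theta>"
        by (simp add: norm_mult algebra_simps)
    qed
    also have "integral {-pi..pi} \<dots> = integral {-pi..pi} (\<lambda>\<theta>. cmod (P \<theta>) * r n \<theta>) +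
        integral {-pi..pi} (\<lambda>\<theta>. cmod (H \<theta> * P \<theta>) * q n \<theta>)"
      by (intro integral_add integrable_continuous_real continuous_intros)
    also have "integral {-pi..pi} (\<lambda>\<theta>. cmod (P \<theta>) * r n \<theta>) \<le> sqrt (2 * pi * C * R n)"
    proof (rule CS)
      have "integral {-pi..pi} (\<lambda>\<theta>. (cmod (P \<theta>))\<^sup>2) = 2 * pi * (\<Sum>m\<in>A. (cmod (c m))\<^sup>2)"
        unfolding P_def by (intro integral_unique trig_polynomial_norm_has_integral A)
      also have "(\<Sum>m\<in>A. (cmod (c m))\<^sup>2) \<le> C"
        unfolding C_def using A c by (intro finite_sum_le_infsum) auto
      finally show "integral {-pi..pi} (\<lambda>\<theta>. (cmod (P \<theta>))\<^sup>2) \<le> 2 * pi * C"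
        by simp
    qed (auto intro!: continuous_intros simp: R_def)
    \<comment> \<open>\<open>H * P\<close> is the Fourier series of the convolution of
      \<open>h\<close> with \<open>c\<close> cut off to \<open>A\<close>, so Parseval turns the
      integral into the sum controlled by \<open>convolution_tail_bound\<close>.\<close>
    also have "integral {-pi..pi} (\<lambda>\<theta>. cmod (H \<theta> * P \<theta>) * q n \<theta>) \<le> sqrt (M * tail A * Q n)"
    proof (rule CS)
      let ?d = "\<lambda>l. \<Sum>m\<in>A. h (l - m) * c m"
      have "integral {-pi..pi} (\<lambda>\<theta>. (cmod (H \<theta> * P \<theta>))\<^sup>2) =
          integral {-pi..pi} (\<lambda>\<theta>. (cmod (fourier_series ?d \<theta>))\<^sup>2)"
        unfolding fourier_series_convolution(2)[OF h A(1)] by (simp add: H_def P_def)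
      also have "\<dots> = (\<Sum>\<^sub>\<infinity>l. 2 * pi * (cmod (?d l))\<^sup>2)"
        by (rule infsumI[OF parseval_abs_summable, symmetric])
           (rule fourier_series_convolution(1)[OF h A(1)])
      also have "\<dots> = 2 * pi * (\<Sum>\<^sub>\<infinity>l. (cmod (?d l))\<^sup>2)"
        by (rule infsum_cmult_right')
      also have "\<dots> \<le> 2 * pi * ((\<Sum>\<^sub>\<infinity>j. cmod (h j))\<^sup>2 * tail A)"
        unfolding tail_def by (intro mult_left_mono convolution_tail_bound h c conv A) auto
      finally show "integral {-pi..pi} (\<lambda>\<theta>. (cmod (H \<theta> * P \<theta>))\<^sup>2) \<le> M * tail A"
        by (simp add: M_def mult_ac)
    qed (auto intro!: continuous_intros simp: Q_def)
    finally show ?thesis by simp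
  qed
  \<comment> \<open>The order of the limits matters: \<open>A\<close> grows first with
    \<open>n\<close> fixed, so that \<open>Q n\<close> is a constant and its term vanishes with the
    tail; only then does \<open>n\<close> grow.\<close>
  have "2 * pi * cmod (c k) \<le> sqrt (2 * pi * C * R n)" for n
  proof (rule tendsto_lowerbound)
    have "((\<lambda>A. sqrt (2 * pi * C * R n) + sqrt (M * tail A * Q n)) \<longlongrightarrow>
        sqrt (2 * pi * C * R n) + sqrt (M * 0 * Q n)) (finite_subsets_at_top UNIV)"
      by (intro tendsto_intros tail_lim)
    then show "((\<lambda>A. sqrt (2 * pi * C * R n) + sqrt (M * tail A * Q n)) \<longlongrightarrow>
        sqrt (2 * pi * C * R n)) (finite_subsets_at_top UNIV)"
      by simp
    show "\<forall>\<^sub>F A in finite_subsets_at_top UNIV.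
        2 * pi * cmod (c k) \<le> sqrt (2 * pi * C * R n) + sqrt (M * tail A * Q n)"
      unfolding eventually_finite_subsets_at_top using key by (intro exI[of _ "{k}"]) auto
  qed simp
  moreover have "(\<lambda>n. sqrt (2 * pi * C * R n)) \<longlonglongrightarrow> sqrt (2 * pi * C * 0)"
    by (intro tendsto_intros R_lim)
  then have "(\<lambda>n. sqrt (2 * pi * C * R n)) \<longlonglongrightarrow> 0"
    by simp
  ultimately have "2 * pi * cmod (c k) \<le> 0"
    by (intro tendsto_lowerbound[OF _ always_eventually]) auto
  then show ?thesis
    using pi_gt_zero by (simp add: mult_le_0_iff)
qed

section \<open>Bessel functions\<close>

text \<open>From \<open>fact (k + n) \<ge> fact n\<close> the power series is dominated by the
  leading term times an exponential series. For \<open>k \<ge> 1\<close> even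
  \<open>fact (k + n) \<ge> fact (n + 1)\<close> holds, which yields the extra factor 1 / (n + 1)
  once the leading term is removed.\<close>

lemma bessel_J_nat_estimates:
  fixes a :: real and n :: nat
  assumes "a \<ge> 0"
  shows "\<bar>bessel_J_nat n a\<bar> \<le> (a / 2) ^ n / fact n * exp ((a / 2)\<^sup>2)"
    and "\<bar>bessel_J_nat n a - (a / 2) ^ n / fact n\<bar> \<le>
      (a / 2) ^ n / fact n * (exp ((a / 2)\<^sup>2) / (n + 1))"
proof -
  define x where "x = a / 2"
  define t where "t k = (-1) ^ k / (fact k * fact (k + n)) * x ^ (2 * k + n)" for k
  define e where "e k = (x\<^sup>2) ^ k / fact k" for k
  have "x \<ge> 0" using assms by (simp add: x_def)
  have e_sums: "e sums exp (x\<^sup>2)"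
    using exp_converges[of "x\<^sup>2"] by (simp add: e_def[abs_def] scaleR_conv_of_real field_simps)
  have e_nonneg: "e k \<ge> 0" for k
    by (simp add: e_def)
  have t_eq: "\<bar>t k\<bar> = x ^ n / fact (k + n) * e k" for k
    using \<open>x \<ge> 0\<close> by (simp add: t_def e_def abs_mult power_add mult_ac flip: power_mult)
  have t_le: "\<bar>t k\<bar> \<le> x ^ n / fact n * e k" for k
    unfolding t_eq using \<open>x \<ge> 0\<close> e_nonneg
    by (intro mult_right_mono divide_left_mono) (auto intro: fact_mono)
  have t_Suc_le: "\<bar>t (Suc k)\<bar> \<le> x ^ n / fact (Suc n) * e (Suc k)" for k
    unfolding t_eq using \<open>x \<ge> 0\<close> e_nonneg
    by (intro mult_right_mono divide_left_mono) (auto intro!: fact_mono simp del: fact_Suc)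
  have bnd: "(\<lambda>k. x ^ n / fact n * e k) sums (x ^ n / fact n * exp (x\<^sup>2))"
    by (intro sums_mult e_sums)
  have t_abs: "summable (\<lambda>k. \<bar>t k\<bar>)"
    by (rule summable_comparison_test'[OF sums_summable[OF bnd], of 0]) (use t_le in auto)
  have J: "bessel_J_nat n a = suminf t"
    by (simp add: bessel_J_nat_def t_def[abs_def] x_def)
  have "\<bar>suminf t\<bar> \<le> (\<Sum>k. \<bar>t k\<bar>)"
    by (rule summable_rabs[OF t_abs])
  also have "\<dots> \<le> (\<Sum>k. x ^ n / fact n * e k)"
    by (intro suminf_le t_le t_abs sums_summable[OF bnd])
  also have "\<dots> = x ^ n / fact n * exp (x\<^sup>2)"
    using bnd by (rule sums_unique[symmetric])
  finally show "\<bar>bessel_J_nat n a\<bar> \<le> (a / 2) ^ n / fact n * exp ((a / 2)\<^sup>2)"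
    by (simp add: J x_def)
  have bnd': "(\<lambda>k. x ^ n / fact (Suc n) * e (Suc k)) sums (x ^ n / fact (Suc n) * (exp (x\<^sup>2) - 1))"
    using e_sums sums_Suc_iff[of e "exp (x\<^sup>2) - 1"] by (intro sums_mult) (simp add: e_def)
  have t_abs': "summable (\<lambda>k. \<bar>t (Suc k)\<bar>)"
    using t_abs by (subst summable_Suc_iff)
  have "suminf t - t 0 = (\<Sum>k. t (Suc k))"
    using suminf_split_head[OF summable_rabs_cancel[OF t_abs]] by simp
  also have "\<bar>\<dots>\<bar> \<le> (\<Sum>k. \<bar>t (Suc k)\<bar>)"
    by (rule summable_rabs[OF t_abs'])
  also have "\<dots> \<le> (\<Sum>k. x ^ n / fact (Suc n) * e (Suc k))"
    by (intro suminf_le t_Suc_le t_abs' sums_summable[OF bnd'])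
  also have "\<dots> = x ^ n / fact (Suc n) * (exp (x\<^sup>2) - 1)"
    using bnd' by (rule sums_unique[symmetric])
  also have "\<dots> \<le> x ^ n / fact (Suc n) * exp (x\<^sup>2)"
    using \<open>x \<ge> 0\<close> by (intro mult_left_mono) auto
  also have "\<dots> = x ^ n / fact n * (exp (x\<^sup>2) / (n + 1))"
    by (simp add: field_simps)
  finally show "\<bar>bessel_J_nat n a - (a / 2) ^ n / fact n\<bar> \<le>
      (a / 2) ^ n / fact n * (exp ((a / 2)\<^sup>2) / (n + 1))"
    by (simp add: J t_def x_def)
qed

text \<open>For such \<open>n\<close> the deviation from the leading term is strictly smaller than
  the leading term itself.\<close>

lemma bessel_J_nat_nonzero:
  assumes "a > 0" "exp ((a / 2)\<^sup>2) < real n + 1"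
  shows "bessel_J_nat n a \<noteq> 0"
proof
  assume "bessel_J_nat n a = 0"
  then have "(a / 2) ^ n / fact n * 1 \<le> (a / 2) ^ n / fact n * (exp ((a / 2)\<^sup>2) / (n + 1))"
    using bessel_J_nat_estimates(2)[of a n] assms(1) by simp
  then have "1 \<le> exp ((a / 2)\<^sup>2) / (n + 1)"
    by (rule mult_left_le_imp_le) (use assms(1) in auto)
  then show False
    using assms(2) by (simp add: field_simps)
qed

lemma abs_bessel_J: "\<bar>bessel_J j a\<bar> = \<bar>bessel_J_nat (nat \<bar>j\<bar>) a\<bar>"
  by (simp add: bessel_J_def abs_mult)

lemma summable_on_int_abs:
  fixes f :: "nat \<Rightarrow> real"
  assumes "f summable_on UNIV"
  shows "(\<lambda>j::int. f (nat \<bar>j\<bar>)) summable_on UNIV"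
proof -
  let ?f = "\<lambda>j::int. f (nat \<bar>j\<bar>)"
  have 1: "?f summable_on range int" "?f summable_on range (\<lambda>n. - int n)"
    using assms by (subst summable_on_reindex; auto simp: o_def inj_on_def)+
  \<comment> \<open>The two ranges overlap in 0, which is removed from the second to make the union
    disjoint.\<close>
  then have "?f summable_on range int \<union> (range (\<lambda>n. - int n) - range int)"
    by (intro summable_on_Un_disjoint) (auto intro: summable_on_subset_banach)
  moreover have "range int \<union> (range (\<lambda>n. - int n) - range int) = UNIV"
    by (auto simp: image_iff) (metis int_cases2)
  ultimately show ?thesis by simp
qed

text \<open>The factorial in the Bessel bound absorbs the weight: up to a constant, the majorant is
  the exponential series at \<open>a / 2 * exp 1\<close>.\<close>

lemma bessel_J_exp_summable:
  assumes "a \<ge> 0"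
  shows "(\<lambda>j. \<bar>bessel_J j a\<bar> * exp \<bar>of_int j\<bar>) summable_on UNIV"
proof -
  have "summable (\<lambda>n. exp ((a / 2)\<^sup>2) * (inverse (fact n) * (a / 2 * exp 1) ^ n))"
    by (intro summable_mult summable_exp)
  then have "(\<lambda>n. exp ((a / 2)\<^sup>2) * (inverse (fact n) * (a / 2 * exp 1) ^ n)) summable_on UNIV"
    by (subst summable_on_UNIV_nonneg_real_iff) (use assms in auto)
  from summable_on_int_abs[OF this] show ?thesis
  proof (rule summable_on_comparison_test)
    fix j :: int
    define n where "n = nat \<bar>j\<bar>"
    have "exp \<bar>of_int j :: real\<bar> = exp 1 ^ n"
      by (simp add: n_def flip: exp_of_nat_mult)
    moreover have "\<bar>bessel_J j a\<bar> \<le> (a / 2) ^ n / fact n * exp ((a / 2)\<^sup>2)"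
      unfolding abs_bessel_J n_def using assms by (rule bessel_J_nat_estimates)
    ultimately have "\<bar>bessel_J j a\<bar> * exp \<bar>of_int j\<bar> \<le> (a / 2) ^ n / fact n * exp ((a / 2)\<^sup>2) * exp 1 ^ n"
      by (intro mult_mono) auto
    also have "\<dots> = exp ((a / 2)\<^sup>2) * (inverse (fact n) * (a / 2 * exp 1) ^ n)"
      unfolding power_mult_distrib by (simp add: field_simps)
    finally show "\<bar>bessel_J j a\<bar> * exp \<bar>of_int j\<bar> \<le>
        exp ((a / 2)\<^sup>2) * (inverse (fact (nat \<bar>j\<bar>)) * (a / 2 * exp 1) ^ nat \<bar>j\<bar>)"
      by (simp add: n_def)
  qed auto
qed

lemma bessel_J_summable:
  assumes "a \<ge> 0"
  shows "(\<lambda>j. \<bar>bessel_J j a\<bar>) summable_on UNIV"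
  by (rule summable_on_comparison_test[OF bessel_J_exp_summable[OF assms]])
     (auto simp: mult_le_cancel_left1)

section \<open>The forward operator\<close>

definition bessel_kernel :: "real \<Rightarrow> int \<Rightarrow> int \<Rightarrow> complex" where
  "bessel_kernel a k j = of_real (bessel_J j a * bessel_J (j - k) a)"

lemma bessel_kernel_exp_summable:
  assumes "a \<ge> 0"
  shows "(\<lambda>j. cmod (bessel_kernel a k j) * exp \<bar>of_int j\<bar>) summable_on UNIV"
proof -
  have "\<bar>bessel_J j a\<bar> \<le> (\<Sum>\<^sub>\<infinity>j. \<bar>bessel_J j a\<bar>)" for j
    using finite_sum_le_infsum[OF bessel_J_summable[OF assms], of "{j}"] by simp
  then have "(\<lambda>j. \<bar>bessel_J j a\<bar> * exp \<bar>of_int j\<bar> * \<bar>bessel_J (j - k) a\<bar>) summable_on UNIV"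
    by (intro summable_on_bounded_mult[OF bessel_J_exp_summable[OF assms]]) auto
  then show ?thesis
    by (simp add: bessel_kernel_def norm_mult abs_mult mult_ac)
qed

lemma bessel_kernel_nonzero:
  assumes "a > 0"
  shows "\<exists>j. bessel_kernel a k j \<noteq> 0"
proof -
  obtain N :: nat where "exp ((a / 2)\<^sup>2) < N"
    using reals_Archimedean2 by blast
  then have "bessel_J j a \<noteq> 0" if "j \<ge> int N" for j
    using that bessel_J_nat_nonzero[OF assms, of "nat j"] by (auto simp: bessel_J_def)
  \<comment> \<open>With this index both orders, \<open>j\<close> and \<open>j - k\<close>, are at
    least \<open>N\<close>.\<close>
  then have "bessel_kernel a k (int N + \<bar>k\<bar>) \<noteq> 0"
    by (simp add: bessel_kernel_def)
  then show ?thesis by blast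
qed

text \<open>The phases of the two matrix entries combine to
  \<open>cis (of_int k * \<theta>)\<close>, free of \<open>l\<close> and \<open>m\<close>. Hence the
  offset of a diagonal of the matrix is its Fourier frequency in \<open>\<theta>\<close>.\<close>

lemma U_entry_diagonal:
  "U_entry g \<theta> l m * r * cnj (U_entry g \<theta> l (m + k)) =
    bessel_kernel (2 * cmod g) k (l - m) * r * cis (of_int k * \<theta>)"
proof -
  have "U_entry g \<theta> l m = cis (of_int (l - m) * \<theta>) * of_real (bessel_J (l - m) (2 * cmod g))" for m
    by (simp add: U_entry_def cis_conv_exp mult_ac)
  moreover have "cis (of_int (l - m) * \<theta>) * cnj (cis (of_int (l - (m + k)) * \<theta>)) = cis (of_int k * \<theta>)"
    by (simp add: cis_cnj cis_mult algebra_simps)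
  ultimately show ?thesis
    by (simp add: bessel_kernel_def diff_diff_eq mult_ac)
qed

text \<open>Enumerates matrix positions by diagonal offset \<open>k\<close> and row
  \<open>m\<close>.\<close>

lemma diagonal_bij: "bij_betw (\<lambda>(k, m). (m, m + k)) UNIV (UNIV :: (int \<times> int) set)"
  by (rule bij_betw_byWitness[where f' = "\<lambda>(m, n). (n - m, m)"]) auto

text \<open>The phases have modulus 1, so the terms are at most \<open>K\<close> times a product of
  two absolutely summable Bessel sequences, one in \<open>m\<close> and one in
  \<open>n\<close>.\<close>

lemma T_op_summable:
  assumes "\<And>m n. cmod (\<rho> m n) \<le> K"
  shows "(\<lambda>(m, n). cmod (U_entry g \<theta> l m * \<rho> m n * cnj (U_entry g \<theta> l n))) summable_on UNIV"
proof -
  let ?J = "\<lambda>m. \<bar>bessel_J (l - m) (2 * cmod g)\<bar>"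
  have J: "?J summable_on UNIV"
    using summable_on_reindex_bij_betw[OF int_reflect_bij, of "\<lambda>j. \<bar>bessel_J j (2 * cmod g)\<bar>" l]
      bessel_J_summable[of "2 * cmod g"] by simp
  have "(\<lambda>(m, n). ?J m * ?J n) summable_on UNIV \<times> UNIV"
    by (rule summable_on_SigmaI[where g = "\<lambda>m. ?J m * infsum ?J UNIV"])
       (auto intro!: has_sum_cmult_right has_sum_infsum summable_on_cmult_left J)
  then have "(\<lambda>p. (case p of (m, n) \<Rightarrow> ?J m * ?J n) * cmod (case p of (m, n) \<Rightarrow> \<rho> m n)) summable_on UNIV"
    by (intro summable_on_bounded_mult[where K = K]) (auto simp: assms)
  moreover have "cmod (U_entry g \<theta> l m * r * cnj (U_entry g \<theta> l n)) = ?J m * ?J n * cmod r" for m n r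
    by (simp add: U_entry_def norm_mult)
  ultimately show ?thesis
    by (simp add: case_prod_unfold)
qed

text \<open>Fubini along diagonals: the inner sum over a diagonal is a convolution at
  \<open>l\<close>, the outer sum over offsets is the Fourier series.\<close>

lemma T_op_fourier_series:
  fixes \<rho> g l
  assumes "\<And>m n. cmod (\<rho> m n) \<le> K"
  defines "W \<equiv> \<lambda>k. \<Sum>\<^sub>\<infinity>m. bessel_kernel (2 * cmod g) k (l - m) * \<rho> m (m + k)"
  shows "(\<lambda>k. cmod (W k)) summable_on UNIV" and "T_op g \<rho> l \<theta> = fourier_series W \<theta>"
proof -
  define f where "f \<theta> k m = bessel_kernel (2 * cmod g) k (l - m) * \<rho> m (m + k) * cis (of_int k * \<theta>)"
    for \<theta> k m
  have abs: "(\<lambda>(k, m). cmod (f \<theta> k m)) summable_on UNIV \<times> UNIV" for \<theta>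
    using summable_on_reindex_bij_betw[OF diagonal_bij,
        of "\<lambda>(m, n). cmod (U_entry g \<theta> l m * \<rho> m n * cnj (U_entry g \<theta> l n))"]
      T_op_summable[OF assms(1), of g \<theta> l]
    by (simp add: U_entry_diagonal f_def case_prod_unfold)
  then have summ: "(\<lambda>(k, m). f \<theta> k m) summable_on UNIV \<times> UNIV" for \<theta>
    using abs_summable_summable[of "\<lambda>(k, m). f \<theta> k m" "UNIV \<times> UNIV"] by (simp add: case_prod_unfold)
  have inner: "(\<Sum>\<^sub>\<infinity>m. f \<theta> k m) = W k * cis (of_int k * \<theta>)" for \<theta> k
    unfolding f_def W_def by (rule infsum_cmult_left')
  \<comment> \<open>At \<open>\<theta> = 0\<close> the phase is 1, so the inner sum is
    \<open>W k\<close> itself.\<close>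
  have "(\<lambda>k. \<Sum>\<^sub>\<infinity>m. cmod (f 0 k m)) summable_on UNIV"
    using summable_on_Sigma_banach[OF abs] by simp
  then show "(\<lambda>k. cmod (W k)) summable_on UNIV"
  proof (rule summable_on_comparison_test)
    fix k
    have "(\<lambda>m. cmod (f 0 k m)) summable_on UNIV"
      using summable_on_SigmaD1[OF abs, of k] by simp
    from norm_infsum_bound[OF this] show "cmod (W k) \<le> (\<Sum>\<^sub>\<infinity>m. cmod (f 0 k m))"
      by (simp add: inner)
  qed auto
  have "T_op g \<rho> l \<theta> = (\<Sum>\<^sub>\<infinity>(k, m). f \<theta> k m)"
    using infsum_reindex_bij_betw[OF diagonal_bij,
        of "\<lambda>(m, n). U_entry g \<theta> l m * \<rho> m n * cnj (U_entry g \<theta> l n)"]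
    by (simp add: T_op_def U_entry_diagonal f_def case_prod_unfold)
  also have "\<dots> = (\<Sum>\<^sub>\<infinity>k. \<Sum>\<^sub>\<infinity>m. f \<theta> k m)"
    using infsum_Sigma'_banach[OF summ] by simp
  finally show "T_op g \<rho> l \<theta> = fourier_series W \<theta>"
    by (simp add: inner fourier_series_def)
qed

section \<open>Additivity of the forward operator and square summable matrices\<close>

lemma T_op_add:
  assumes "\<And>m n. cmod (\<rho>1 m n) \<le> K1" "\<And>m n. cmod (\<rho>2 m n) \<le> K2"
  shows "T_op g (\<lambda>m n. \<rho>1 m n + \<rho>2 m n) l \<theta> = T_op g \<rho>1 l \<theta> + T_op g \<rho>2 l \<theta>"
proof -
  \<comment> \<open>Infinite sums add for summable families; boundedness of the entries provides
    this.\<close>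
  have summ: "(\<lambda>(m, n). U_entry g \<theta> l m * \<rho> m n * cnj (U_entry g \<theta> l n)) summable_on UNIV"
    if "\<And>m n. cmod (\<rho> m n) \<le> K" for \<rho> K
    by (rule abs_summable_summable) (use T_op_summable[OF that] in \<open>simp add: case_prod_unfold\<close>)
  show ?thesis
    unfolding T_op_def infsum_add[OF summ[OF assms(1)] summ[OF assms(2)], symmetric]
    by (intro infsum_cong) (auto simp: algebra_simps)
qed

lemma ell2_ZZ_bounded:
  assumes "ell2_ZZ \<rho>"
  shows "\<exists>K. \<forall>m n. cmod (\<rho> m n) \<le> K"
proof -
  have "(\<lambda>p. (cmod (case p of (m, n) \<Rightarrow> \<rho> m n))\<^sup>2) summable_on UNIV"
    using assms by (simp add: ell2_ZZ_def case_prod_unfold)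
  from square_summable_bounded[OF this] show ?thesis
    by (metis case_prod_conv)
qed

lemma ell2_ZZ_diff:
  assumes "ell2_ZZ \<rho>1" "ell2_ZZ \<rho>2"
  shows "ell2_ZZ (\<lambda>m n. \<rho>1 m n - \<rho>2 m n)"
  unfolding ell2_ZZ_def
proof (rule summable_on_comparison_test)
  show "(\<lambda>p. 2 * (case p of (m, n) \<Rightarrow> (cmod (\<rho>1 m n))\<^sup>2) + 2 * (case p of (m, n) \<Rightarrow> (cmod (\<rho>2 m n))\<^sup>2))
      summable_on UNIV"
    using assms unfolding ell2_ZZ_def by (intro summable_on_add summable_on_cmult_right)
  have "(cmod (x - y))\<^sup>2 \<le> 2 * (cmod x)\<^sup>2 + 2 * (cmod y)\<^sup>2" for x y
  proof -
    have "(cmod (x - y))\<^sup>2 \<le> (cmod x + cmod y)\<^sup>2"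
      by (intro power_mono norm_triangle_ineq4) auto
    also have "\<dots> \<le> 2 * (cmod x)\<^sup>2 + 2 * (cmod y)\<^sup>2"
      using sum_squares_ge_zero[of "cmod x - cmod y" 0] by (simp add: power2_eq_square algebra_simps)
    finally show ?thesis .
  qed
  then show "(case p of (m, n) \<Rightarrow> (cmod (\<rho>1 m n - \<rho>2 m n))\<^sup>2) \<le>
      2 * (case p of (m, n) \<Rightarrow> (cmod (\<rho>1 m n))\<^sup>2) + 2 * (case p of (m, n) \<Rightarrow> (cmod (\<rho>2 m n))\<^sup>2)" for p
    by (cases p) simp
qed auto

theorem theorem1:
  fixes g :: complex and \<rho>1 \<rho>2 :: "int \<Rightarrow> int \<Rightarrow> complex"
  assumes "g \<noteq> 0"
    and "ell2_ZZ \<rho>1" and "ell2_ZZ \<rho>2"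
    and "\<forall>l. AE \<theta> in lborel. \<theta> \<in> {-pi..pi} \<longrightarrow> T_op g \<rho>1 l \<theta> = T_op g \<rho>2 l \<theta>"
  shows "\<rho>1 = \<rho>2"
proof -
  define \<rho> where "\<rho> m n = \<rho>1 m n - \<rho>2 m n" for m n
  let ?h = "bessel_kernel (2 * cmod g)"
  have a: "2 * cmod g > 0" using assms(1) by simp
  have \<rho>: "ell2_ZZ \<rho>"
    unfolding \<rho>_def[abs_def] by (rule ell2_ZZ_diff[OF assms(2,3)])
  obtain K2 K where K: "\<And>m n. cmod (\<rho>2 m n) \<le> K2" "\<And>m n. cmod (\<rho> m n) \<le> K"
    using ell2_ZZ_bounded[OF assms(3)] ell2_ZZ_bounded[OF \<rho>] by blast
  \<comment> \<open>For fixed \<open>l\<close>, these are the Fourier coefficients of the image of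
    the difference \<open>\<rho>\<close>, which vanishes almost everywhere.\<close>
  have conv: "(\<Sum>\<^sub>\<infinity>m. ?h k (l - m) * \<rho> m (m + k)) = 0" for k l
  proof (rule fourier_series_AE_zero[where d = "\<lambda>k. \<Sum>\<^sub>\<infinity>m. ?h k (l - m) * \<rho> m (m + k)"])
    show "(\<lambda>k. cmod (\<Sum>\<^sub>\<infinity>m. ?h k (l - m) * \<rho> m (m + k))) summable_on UNIV"
      by (rule T_op_fourier_series(1)[where \<rho> = \<rho>, OF K(2)])
    have "AE \<theta> in lborel. \<theta> \<in> {-pi..pi} \<longrightarrow> T_op g \<rho>1 l \<theta> = T_op g \<rho>2 l \<theta>"
      using assms(4) by blast
    moreover have "T_op g \<rho>1 l \<theta> = T_op g \<rho> l \<theta> + T_op g \<rho>2 l \<theta>" for \<theta>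
      using T_op_add[of \<rho> K \<rho>2 K2 g l \<theta>] K by (simp add: \<rho>_def)
    ultimately have "AE \<theta> in lborel. \<theta> \<in> {-pi..pi} \<longrightarrow> T_op g \<rho> l \<theta> = 0"
      by simp
    then show "AE \<theta> in lborel. \<theta> \<in> {-pi..pi} \<longrightarrow>
        fourier_series (\<lambda>k. \<Sum>\<^sub>\<infinity>m. ?h k (l - m) * \<rho> m (m + k)) \<theta> = 0"
      unfolding T_op_fourier_series(2)[where \<rho> = \<rho>, OF K(2)] .
  qed
  \<comment> \<open>Each diagonal is a square summable sequence annihilated by convolution with its
    own kernel \<open>?h k\<close>.\<close>
  have diagonal: "\<rho> m (m + k) = 0" for m k
  proof (rule convolution_kernel_trivial[of "?h k" "\<lambda>m. \<rho> m (m + k)"])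
    have exp_summable: "(\<lambda>j. cmod (?h k j) * exp \<bar>of_int j\<bar>) summable_on UNIV"
      using a by (intro bessel_kernel_exp_summable) simp
    then show "(\<lambda>j. cmod (?h k j)) summable_on UNIV"
      by (rule summable_on_comparison_test) (auto simp: mult_le_cancel_left1)
    obtain j where "?h k j \<noteq> 0"
      using bessel_kernel_nonzero[OF a] by blast
    then show "negligible {\<theta> \<in> {-pi..pi}. fourier_series (?h k) \<theta> = 0}"
      by (rule fourier_series_zeros_negligible[OF exp_summable])
    \<comment> \<open>Square summability over all positions restricts to the diagonal of offset
      \<open>k\<close>, parametrised injectively by its row.\<close>
    have "(\<lambda>(m, n). (cmod (\<rho> m n))\<^sup>2) summable_on range (\<lambda>m. (m, m + k))"
      using \<rho> unfolding ell2_ZZ_def by (rule summable_on_subset_banach) simp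
    then show "(\<lambda>m. (cmod (\<rho> m (m + k)))\<^sup>2) summable_on UNIV"
      by (subst (asm) summable_on_reindex) (auto simp: inj_on_def o_def)
    show "(\<Sum>\<^sub>\<infinity>m. ?h k (l - m) * \<rho> m (m + k)) = 0" for l
      by (rule conv)
  qed
  have "\<rho>1 m n = \<rho>2 m n" for m n
    using diagonal[of m "n - m"] by (simp add: \<rho>_def)
  then show ?thesis
    by (intro ext)
qed

end
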